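(* For any game with activeness $G^g$: (i) $\mathcal{G}^{\bm{1}}(G^g)=\{\mathrm{mex}\bigcup_{G'^{g'}\in G^g}\mathcal{G}^{\bm{1}}(G'^{g'})\}$. (ii) $\mathcal{G}^{\bm{0}}(G^g)=\mathbb{Z}_{\ge0}$ if $\mathrm{type}(G^g)=0$; $\mathcal{G}^{\bm{0}}(G^g)=\emptyset$ if $\mathrm{type}(G^g)=1_{\exists0}$; and $\mathcal{G}^{\bm{0}}(G^g)=\{\mathrm{mex}\bigcup_{G'^{g'}\in G^g,\ \mathrm{type}(G'^{g'})=1_{\forall1}}\mathcal{G}^{\bm{0}}(G'^{g'})\}$ if $\mathrm{type}(G^g)=1_{\forall1}$.
   Context: Let $\mathcal{B}=\{0,1\}$. Define $\mathbb{I}_0=\{\emptyset\}\times\mathcal{B}$ and $\mathbb{I}_n=2^{\mathbb{I}_{n-1}}\times\mathcal{B}$ for $n\ge1$; a game with activeness is an element of $\mathbb{I}=\bigcup_{n\ge0}\mathbb{I}_n$. A pair $(G,g)$ is written $G^g$; elements of $G$ are its options, $g=1$ meaning active. The outcome $o$ is defined recursively: $o(G^g)=\mathscr{N}$ if $g=1$ and some option has outcome $\mathscr{P}$, and $o(G^g)=\mathscr{P}$ otherwise. The sum is $G^g+H^h=(\{G'^{g'}+H^h:G'^{g'}\in G^g\}\cup\{G^g+H'^{h'}:H'^{h'}\in H^h\})^{\max\{g,h\}}$. For $\bm{\gamma}\in\mathcal{B}^\infty$, ${\ast}^{\bm{\gamma}}i=\{{\ast}^{\bm{\gamma}}j:0\le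 j<i\}^{\gamma_i}$ recursively, and $\mathcal{G}^{\bm{\gamma}}(G^g)=\{n\in\mathbb{Z}_{\ge0}:o(G^g+{\ast}^{\bm{\gamma}}n)=\mathscr{P}\}$; $\bm{0}=(0,0,\ldots)$, $\bm{1}=(1,1,\ldots)$. $\mathrm{mex}\,S=\min(\mathbb{Z}_{\ge0}\setminus S)$. $\mathrm{type}(G^g)$ is $0$ if $g=0$; $1_{\exists0}$ if $g=1$ and some option $G'^{g'}$ has $g'=0$; $1_{\forall1}$ if $g=1$ and every option has activeness $1$. *)

theory Defs
  imports Main "HOL-Library.FSet"
begin

text \<open>
  Every \<open>\<I>\<^sub>n\<close> is finite, so a game with activeness is a hereditarily finite set in
  which each set carries a bit. The bits \<open>0\<close> and \<open>1\<close> are \<^const>\<open>False\<close> and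
  \<^const>\<open>True\<close>. The lemma \<open>Union_games_level\<close> below shows that this type is exactly the
  union of the levels \<open>\<I>\<^sub>n\<close>.
\<close>

datatype game = Game (options: "game fset") (active: bool)

fun games_level :: "nat \<Rightarrow> game set" where
  "games_level 0 = {Game {||} g |g. True}"
| "games_level (Suc n) = {Game G g |G g. fset G \<subseteq> games_level n}"

lemma games_level_mono: "m \<le> n \<Longrightarrow> games_level m \<subseteq> games_level n"
proof -
  have step: "games_level k \<subseteq> games_level (Suc k)" for k
    by (induction k) auto
  show "games_level m \<subseteq> games_level n" if "m \<le> n"
    using lift_Suc_mono_le[of games_level, OF step that] .
qed

lemma finite_games_level: "finite (games_level n)"
proof (induction n)
  case 0
  have "games_level 0 = range (Game {||})" by auto
  then show ?case by simp
next
  case (Suc n)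
  have "games_level (Suc n)
      \<subseteq> (\<lambda>(A, g). Game (Abs_fset A) g) ` (Pow (games_level n) \<times> UNIV)"
  proof
    fix x assume "x \<in> games_level (Suc n)"
    then obtain G g where "x = Game G g" "fset G \<subseteq> games_level n" by auto
    then show "x \<in> (\<lambda>(A, g). Game (Abs_fset A) g) ` (Pow (games_level n) \<times> UNIV)"
      by (intro image_eqI[of _ _ "(fset G, g)"]) (simp_all add: fset_inverse)
  qed
  moreover have "finite (Pow (games_level n) \<times> (UNIV :: bool set))"
    using Suc by simp
  ultimately show ?case by (rule finite_surj[rotated])
qed

lemma Union_games_level: "(\<Union>n. games_level n) = UNIV"
proof -
  have "\<exists>n. G \<in> games_level n" for G
  proof (induction G)
    case (Game G g)
    then obtain f where f: "\<And>G'. G' \<in> fset G \<Longrightarrow> G' \<in> games_level (f G')"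
      by metis
    have "G' \<in> games_level (Max (f ` fset G))" if "G' \<in> fset G" for G'
      using f[OF that] that games_level_mono[of "f G'" "Max (f ` fset G)"] by auto
    then have "Game G g \<in> games_level (Suc (Max (f ` fset G)))" by auto
    then show ?case by blast
  qed
  then show ?thesis by blast
qed

lemma size_option: "G' |\<in>| G \<Longrightarrow> size G' < size (Game G g)"
proof -
  assume "G' |\<in>| G"
  then have "size G' \<le> (\<Sum>x\<in>fset G. Suc (size x))"
    using member_le_sum[of G' "fset G" "\<lambda>x. Suc (size x)"] by simp
  then show ?thesis by simp
qed

datatype game_outcome = Out_N | Out_P

function outcome :: "game \<Rightarrow> game_outcome" where
  "outcome (Game G g) = (if g \<and> (\<exists>G' |\<in>| G. outcome G' = Out_P) then Out_N else Out_P)"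
  by pat_completeness auto
termination by (relation "measure size") (auto simp del: game.size intro: size_option)

function game_plus :: "game \<Rightarrow> game \<Rightarrow> game" (infixl "\<oplus>" 65) where
  "Game G g \<oplus> Game H h =
     Game ((\<lambda>G'. G' \<oplus> Game H h) |`| G |\<union>| (\<lambda>H'. Game G g \<oplus> H') |`| H) (max g h)"
  by pat_completeness auto
termination
  by (relation "measure (\<lambda>(G, H). size G + size H)") (auto simp del: game.size intro: size_option)

fun star :: "(nat \<Rightarrow> bool) \<Rightarrow> nat \<Rightarrow> game" where
  "star \<gamma> i = Game (fset_of_list (map (star \<gamma>) [0..<i])) (\<gamma> i)"

declare star.simps [simp del]

definition Gval :: "(nat \<Rightarrow> bool) \<Rightarrow> game \<Rightarrow> nat set" where
  "Gval \<gamma> G = {n. outcome (G \<oplus> star \<gamma> n) = Out_P}"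

definition zeros :: "nat \<Rightarrow> bool" where
  "zeros = (\<lambda>_. False)"

definition ones :: "nat \<Rightarrow> bool" where
  "ones = (\<lambda>_. True)"

definition mex :: "nat set \<Rightarrow> nat" where
  "mex S = (LEAST n. n \<notin> S)"

datatype gtype = Type_0 | Type_1_ex0 | Type_1_all1

definition game_type :: "game \<Rightarrow> gtype" where
  "game_type G =
     (if \<not> active G then Type_0
      else if \<exists>G' |\<in>| options G. \<not> active G' then Type_1_ex0
      else Type_1_all1)"

end

theory Submission
  imports Defs
begin

text \<open>
  If \<open>G \<oplus> star \<gamma> n\<close> is active, then \<open>n\<close> lies in \<open>Gval \<gamma> G\<close> iff it lies in no
  \<open>Gval \<gamma> G'\<close> for an option \<open>G'\<close> of \<open>G\<close> and no smaller number lies in \<open>Gval \<gamma> G\<close>. If every such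
  sum is active, the least number outside the union over the options is therefore the only
  element. That least number exists because the union is finite, by induction on \<open>G\<close>. For
  \<open>\<gamma> = 0\<close> the sum is active iff \<open>G\<close> is, and an inactive option, whose value is all of the
  naturals, leaves nothing for \<open>G\<close>.
\<close>

lemma Gval_iff:
  "n \<in> Gval \<gamma> G \<longleftrightarrow>
     (active G \<or> \<gamma> n \<longrightarrow> n \<notin> (\<Union>G' \<in> fset (options G). Gval \<gamma> G') \<and> (\<forall>j<n. j \<notin> Gval \<gamma> G))"
proof (cases G)
  case (Game H g)
  \<comment> \<open>Moves in the second summand lead from \<open>star \<gamma> n\<close> to
    \<open>star \<gamma> j\<close> with \<open>j < n\<close>; they give the clause on smaller
    numbers.\<close>
  have "Game H g \<oplus> star \<gamma> n =
      Game ((\<lambda>G'. G' \<oplus> star \<gamma> n) |`| H |\<union>| (\<lambda>j. Game H g \<oplus> star \<gamma> j) |`| fset_of_list [0..<n])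
        (g \<or> \<gamma> n)"
    unfolding star.simps[of \<gamma> n]
    by (auto simp: fset_of_list_map fset.map_comp comp_def max_def)
  then show ?thesis
    unfolding Game Gval_def by (auto simp: fset_of_list_elem)
qed

lemma eq_mexI:
  assumes "finite U" and A: "\<And>n. n \<in> A \<longleftrightarrow> n \<notin> U \<and> (\<forall>j<n. j \<notin> A)"
  shows "A = {mex U}"
proof -
  have "\<exists>n. n \<notin> U"
    using \<open>finite U\<close> ex_new_if_finite infinite_UNIV_nat by blast
  then have out: "mex U \<notin> U"
    unfolding mex_def by (rule LeastI_ex)
  have below: "j \<in> U" if "j < mex U" for j
    using not_less_Least that unfolding mex_def by blast
  \<comment> \<open>Each \<open>j < mex U\<close> lies in \<open>U\<close>, hence not in
    \<open>A\<close>.\<close>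
  have "mex U \<in> A"
    using A out below by blast
  \<comment> \<open>Larger numbers are excluded by \<open>mex U\<close> itself.\<close>
  then show ?thesis
    using A below by (metis linorder_neqE_nat set_eqI singleton_iff)
qed

lemma Gval_ones: "Gval ones G = {mex (\<Union>G' \<in> fset (options G). Gval ones G')}"
proof (induction G)
  case (Game H g)
  \<comment> \<open>By the induction hypothesis this is a singleton.\<close>
  have "finite (Gval ones G')" if "G' \<in> fset H" for G'
    by (subst Game[OF that]) simp
  then have "finite (\<Union>G' \<in> fset (options (Game H g)). Gval ones G')"
    by simp
  then show ?case
    by (rule eq_mexI) (subst Gval_iff, simp add: ones_def)
qed

lemma Gval_zeros_Type_0: "game_type G = Type_0 \<Longrightarrow> Gval zeros G = UNIV"
  using Gval_iff[of _ zeros G] by (auto simp: game_type_def zeros_def split: if_splits)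

lemma Gval_zeros_Type_1_ex0:
  assumes "game_type G = Type_1_ex0"
  shows "Gval zeros G = {}"
proof -
  obtain G' where "active G" "G' \<in> fset (options G)" "\<not> active G'"
    using assms by (auto simp: game_type_def split: if_splits)
  moreover from this have "Gval zeros G' = UNIV"
    by (simp add: Gval_zeros_Type_0 game_type_def)
  ultimately show ?thesis
    using Gval_iff[of _ zeros G] by blast
qed

lemma Gval_zeros_Type_1_all1:
  "game_type G = Type_1_all1 \<Longrightarrow>
     Gval zeros G =
       {mex (\<Union>G' \<in> {G' \<in> fset (options G). game_type G' = Type_1_all1}. Gval zeros G')}"
proof (induction G)
  case (Game H g)
  let ?U = "\<Union>G' \<in> {G' \<in> fset H. game_type G' = Type_1_all1}. Gval zeros G'"
  have "active (Game H g)" and opts: "\<And>G'. G' \<in> fset H \<Longrightarrow> active G'"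
    using Game.prems by (auto simp: game_type_def split: if_splits)
  \<comment> \<open>All options are active, so those outside \<open>Type_1_all1\<close> have type
    \<open>Type_1_ex0\<close> and add nothing to the union.\<close>
  have "game_type G' \<noteq> Type_0" if "G' \<in> fset H" for G'
    using opts[OF that] by (simp add: game_type_def)
  then have "Gval zeros G' = {}" if "G' \<in> fset H" "game_type G' \<noteq> Type_1_all1" for G'
    using that by (metis Gval_zeros_Type_1_ex0 gtype.exhaust)
  then have U: "(\<Union>G' \<in> fset H. Gval zeros G') = ?U"
    by blast
  have "finite (Gval zeros G')" if "G' \<in> fset H" "game_type G' = Type_1_all1" for G'
    by (subst Game.IH[OF that]) simp
  then have "finite ?U"
    by simp
  then have "Gval zeros (Game H g) = {mex ?U}"
    by (rule eq_mexI)
      (subst Gval_iff, use \<open>active (Game H g)\<close> in \<open>simp only: game.sel U simp_thms\<close>)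
  then show ?case
    by simp
qed

theorem theorem3p16:
  fixes G :: game
  shows "Gval ones G = {mex (\<Union>G' \<in> fset (options G). Gval ones G')}
    \<and> (game_type G = Type_0 \<longrightarrow> Gval zeros G = UNIV)
    \<and> (game_type G = Type_1_ex0 \<longrightarrow> Gval zeros G = {})
    \<and> (game_type G = Type_1_all1 \<longrightarrow>
         Gval zeros G =
           {mex (\<Union>G' \<in> {G' \<in> fset (options G). game_type G' = Type_1_all1}. Gval zeros G')})"
  using Gval_ones Gval_zeros_Type_0 Gval_zeros_Type_1_ex0 Gval_zeros_Type_1_all1 by blast

end
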